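(* Let $\alpha > -1$. Then for all integers $m,n\ge0$: $$(m + n + \alpha + 1) P^{(\alpha)}_{m,n} = \frac{(m + \alpha + 1) (n + \alpha + 1)}{\alpha + 1} P^{(\alpha+1)}_{m,n} - \frac{m \, n}{\alpha + 1} P^{(\alpha+1)}_{m-1, n-1},$$ $$(m + n + \alpha + 1) P^{(\alpha)}_{m,n} = \frac{n + \alpha + 1}{n + 1}\, \partial_{z^*} P^{(\alpha)}_{m,n+1} - \frac{m}{m + \alpha}\, \partial_{z^*} P^{(\alpha)}_{m-1, n},$$ and $$(m + n + \alpha + 1) P^{(\alpha)}_{m,n} = \frac{m + \alpha + 1}{m + 1}\, \partial_z P^{(\alpha)}_{m+1,n} - \frac{n}{n + \alpha}\, \partial_z P^{(\alpha)}_{m,n-1}.$$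
   Context: $B^2$ is the open unit disk of $\mathbb{R}^2$ with polar coordinates $(r,\theta)$. For $\alpha>-1$ and integers $m,n\ge0$ the Zernike polynomial $P^{(\alpha)}_{m,n}\colon B^2\to\mathbb{C}$ is $$P^{(\alpha)}_{m,n} = \frac{\Gamma(\min(m,n)+1)\, \Gamma(\alpha+1)}{\Gamma(\min(m,n) + \alpha + 1)}\, r^{|m-n|} e^{\mathrm{i} (m-n) \theta}\, P^{(\alpha,|m-n|)}_{\min(m,n)}(2r^2-1),$$ where $P^{(a,b)}_k$ is the Jacobi polynomial of degree $k$, orthogonal on $(-1,1)$ with respect to $(1-t)^a(1+t)^b$ and normalized by $P^{(a,b)}_k(1)=\binom{k+a}{k}$. Convention: $P^{(\alpha)}_{m,n}\equiv0$ if $m<0$ or $n<0$; any term containing such a polynomial is zero (also when $\alpha=0$ and its scalar prefactor reads $0/0$). The differential operators are $\partial_{z^*}=\frac12(\partial_1+\mathrm{i}\,\partial_2)$ and $\partial_z=\frac12(\partial_1-\mathrm{i}\,\partial_2)$. *)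

theory Defs
  imports "HOL-Analysis.Analysis" "HOL-Computational_Algebra.Polynomial"
begin

text \<open>
  For \<open>a, b > - 1\<close> exactly one polynomial satisfies \<open>is_jacobi_poly k a b\<close>, so that the
  description in \<open>jacobi_poly\<close> is proper; no claim is made for other parameters.
  Orthogonality is, as usual, orthogonality to all polynomials of lower degree.
\<close>

definition is_jacobi_poly :: "nat \<Rightarrow> real \<Rightarrow> real \<Rightarrow> real poly \<Rightarrow> bool" where
  "is_jacobi_poly k a b p \<longleftrightarrow>
     degree p = k \<and>
     (\<forall>q. degree q < k \<longrightarrow>
        ((\<lambda>t. (1 - t) powr a * (1 + t) powr b * poly p t * poly q t) has_integral 0) {-1<..<1}) \<and>
     poly p 1 = (real k + a) gchoose k"

definition jacobi_poly :: "nat \<Rightarrow> real \<Rightarrow> real \<Rightarrow> real poly" where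
  "jacobi_poly k a b = (THE p. is_jacobi_poly k a b p)"

text \<open>
  The plane is identified with the type of complex numbers, with polar coordinates
  \<open>r = cmod z\<close> and \<open>\<theta> = Arg z\<close>. The choice of the angle at the origin is immaterial: there
  \<open>r ^ \<bar>m - n\<bar>\<close> is zero unless \<open>m = n\<close>, and for \<open>m = n\<close> the angle does not enter.
  The formula is used on the whole plane, but only its restriction to the open unit disk matters.
\<close>

definition zernike :: "real \<Rightarrow> int \<Rightarrow> int \<Rightarrow> complex \<Rightarrow> complex" where
  "zernike \<alpha> m n z =
     (if m < 0 \<or> n < 0 then 0
      else of_real (Gamma (of_int (min m n) + 1) * Gamma (\<alpha> + 1) / Gamma (of_int (min m n) + \<alpha> + 1))
         * of_real (cmod z ^ nat \<bar>m - n\<bar>)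
         * exp (\<i> * of_int (m - n) * of_real (Arg z))
         * of_real (poly (jacobi_poly (nat (min m n)) \<alpha> (of_int \<bar>m - n\<bar>)) (2 * (cmod z)\<^sup>2 - 1)))"

definition partial1 :: "(complex \<Rightarrow> complex) \<Rightarrow> complex \<Rightarrow> complex" where
  "partial1 f z = vector_derivative (\<lambda>x. f (Complex x (Im z))) (at (Re z))"

definition partial2 :: "(complex \<Rightarrow> complex) \<Rightarrow> complex \<Rightarrow> complex" where
  "partial2 f z = vector_derivative (\<lambda>y. f (Complex (Re z) y)) (at (Im z))"

definition deriv_z :: "(complex \<Rightarrow> complex) \<Rightarrow> complex \<Rightarrow> complex" where
  "deriv_z f z = (partial1 f z - \<i> * partial2 f z) / 2"

definition deriv_zstar :: "(complex \<Rightarrow> complex) \<Rightarrow> complex \<Rightarrow> complex" where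
  "deriv_zstar f z = (partial1 f z + \<i> * partial2 f z) / 2"

end

theory Submission
  imports Defs
begin

text \<open>
  Expanding the Jacobi polynomial in powers of \<open>(1 + t) / 2 = r\<^sup>2\<close> turns the Zernike polynomial into
  \<open>\<Sum>\<^sub>j c\<^sub>j z^(m - j) (z*)^(n - j)\<close> with
  \<open>c\<^sub>j = (- 1)^j (\<alpha> + 1)[m + n - j] j! binom(m, j) binom(n, j) / ((\<alpha> + 1)[m] (\<alpha> + 1)[n])\<close>, where
  \<open>x[i]\<close> denotes the rising factorial. All three identities then hold coefficientwise.
  Since the Jacobi polynomial is specified by orthogonality, its explicit form has to be identified:
  the moments against \<open>(1 - t)^l\<close> are Beta integrals whose alternating sum is a \<open>k\<close>-th finite
  difference of a polynomial of degree \<open>k - l - 1\<close>, and the value at \<open>1\<close> is Vandermonde's identity.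
\<close>

section \<open>Jacobi polynomials with integer second parameter\<close>

text \<open>Pascal's rule: a difference of order \<open>k + 1\<close> is a difference of order
  \<open>k\<close> of the first differences.\<close>

lemma alternating_binomial_sum_Suc:
  fixes f :: "nat \<Rightarrow> real"
  shows "(\<Sum>i\<le>Suc k. (- 1) ^ i * of_nat (Suc k choose i) * f i) =
         (\<Sum>i\<le>k. (- 1) ^ i * of_nat (k choose i) * (f i - f (Suc i)))"
proof -
  have "(\<Sum>i\<le>k. (- 1) ^ i * of_nat (k choose i) * f i) =
        (\<Sum>i\<le>Suc k. (- 1) ^ i * of_nat (k choose i) * f i)"
    by simp
  also have "\<dots> = f 0 - (\<Sum>i\<le>k. (- 1) ^ i * of_nat (k choose Suc i) * f (Suc i))"
    by (subst sum.atMost_Suc_shift) (simp add: sum_negf)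
  finally have *: "(\<Sum>i\<le>k. (- 1) ^ i * of_nat (k choose i) * f i) = \<dots>" .
  show ?thesis
    using * by (subst sum.atMost_Suc_shift)
      (simp add: sum_negf sum.distrib sum_subtractf algebra_simps)
qed

text \<open>Differencing a rising factorial lowers its length by one and moves its base from
  \<open>y\<close> to \<open>y + 1\<close>, hence the induction over arbitrary \<open>y\<close> and
  \<open>d\<close>. After \<open>d < k\<close> differences a constant is left, and the next one
  kills it.\<close>

lemma alternating_binomial_sum_pochhammer:
  fixes y :: real
  assumes "d < k"
  shows "(\<Sum>i\<le>k. (- 1) ^ i * of_nat (k choose i) * pochhammer (y + of_nat i) d) = 0"
  using assms
proof (induction k arbitrary: y d)
  case (Suc k)
  have diff: "pochhammer (y + of_nat i) d - pochhammer (y + of_nat (Suc i)) d =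
      - of_nat d * pochhammer (y + 1 + of_nat i) (d - 1)" for i
  proof (cases d)
    case (Suc e)
    have "pochhammer (y + of_nat i) d = (y + of_nat i) * pochhammer (y + of_nat i + 1) e"
      by (simp add: Suc pochhammer_rec)
    moreover have "pochhammer (y + of_nat (Suc i)) d =
        pochhammer (y + of_nat i + 1) e * (y + of_nat i + 1 + of_nat e)"
      by (simp add: Suc pochhammer_Suc add_ac)
    ultimately show ?thesis by (simp add: Suc algebra_simps)
  qed simp
  have "(\<Sum>i\<le>Suc k. (- 1) ^ i * of_nat (Suc k choose i) * pochhammer (y + of_nat i) d) =
        (\<Sum>i\<le>k. (- 1) ^ i * of_nat (k choose i) *
          (- of_nat d * pochhammer (y + 1 + of_nat i) (d - 1)))"
    by (simp only: alternating_binomial_sum_Suc diff)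
  also have "\<dots> = - of_nat d *
      (\<Sum>i\<le>k. (- 1) ^ i * of_nat (k choose i) * pochhammer (y + 1 + of_nat i) (d - 1))"
    by (simp add: sum_distrib_left mult_ac)
  also have "\<dots> = 0"
  \<comment> \<open>For \<open>d = 0\<close> the prefactor vanishes, so the truncated
    \<open>d - 1\<close> does no harm.\<close>
  proof (cases "d = 0")
    case False
    then have "d - 1 < k" using Suc.prems by simp
    then show ?thesis using Suc.IH by simp
  qed simp
  finally show ?case .
qed simp

section \<open>The explicit Jacobi polynomial\<close>

text \<open>These are the coefficients of the hypergeometric expansion at \<open>t = - 1\<close>,
  that is of (-1)^k binom(k+b, k) 2F1(-k, k+a+b+1; b+1; (1+t)/2). With \<open>b\<close> natural the
  Gamma quotients in \<open>b\<close> become a binomial coefficient.\<close>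

definition jacobi_coeff :: "nat \<Rightarrow> real \<Rightarrow> nat \<Rightarrow> nat \<Rightarrow> real" where
  "jacobi_coeff k a b i =
     (- 1) ^ (k + i) * pochhammer (a + real k + real b + 1) i * of_nat ((k + b) choose (k - i)) / fact i"

definition jacobi_explicit :: "nat \<Rightarrow> real \<Rightarrow> nat \<Rightarrow> real poly" where
  "jacobi_explicit k a b = (\<Sum>i\<le>k. monom (jacobi_coeff k a b i) i) \<circ>\<^sub>p [:1 / 2, 1 / 2:]"

lemma poly_jacobi_explicit:
  "poly (jacobi_explicit k a b) t = (\<Sum>i\<le>k. jacobi_coeff k a b i * ((1 + t) / 2) ^ i)"
  by (simp add: jacobi_explicit_def poly_pcompose poly_sum poly_monom add_divide_distrib)

lemma degree_jacobi_explicit: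
  assumes "a > - 1"
  shows "degree (jacobi_explicit k a b) = k"
proof -
  have coeff: "coeff (\<Sum>i\<le>k. monom (jacobi_coeff k a b i) i) j =
      (if j \<le> k then jacobi_coeff k a b j else 0)" for j
    by (simp add: coeff_sum)
  have "pochhammer (a + real k + real b + 1) k > 0"
    using assms by (intro pochhammer_pos) auto
  then have "jacobi_coeff k a b k \<noteq> 0"
    by (auto simp: jacobi_coeff_def)
  then have "degree (\<Sum>i\<le>k. monom (jacobi_coeff k a b i) i) = k"
    by (intro antisym degree_le le_degree) (auto simp: coeff)
  then show ?thesis
    by (simp add: jacobi_explicit_def degree_pcompose)
qed

lemma poly_jacobi_explicit_1:
  "poly (jacobi_explicit k a b) 1 = (real k + a) gchoose k"
proof -
  define y where "y = a + real k + real b + 1"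
  \<comment> \<open>The sign, the rising factorial of \<open>y\<close> and \<open>fact i\<close>
    combine to \<open>- y gchoose i\<close>, which turns the sum into a Vandermonde convolution with
    upper entries adding up to \<open>- (a + 1)\<close>.\<close>
  have "poly (jacobi_explicit k a b) 1 =
      (- 1) ^ k * (\<Sum>i=0..k. (- y gchoose i) * (real (k + b) gchoose (k - i)))"
    by (simp add: poly_jacobi_explicit jacobi_coeff_def gbinomial_pochhammer[of "- y"]
        binomial_gbinomial power_add sum_distrib_left atLeast0AtMost mult_ac flip: y_def)
  also have "\<dots> = (- 1) ^ k * (- (a + 1) gchoose k)"
    by (simp add: gbinomial_Vandermonde y_def)
  also have "\<dots> = (real k + a) gchoose k"
    by (simp add: gbinomial_minus' add.commute)
  finally show ?thesis .
qed

lemma gbinomial_add_pos: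
  fixes a :: real
  assumes "a > - 1"
  shows "(real k + a) gchoose k > 0"
  using assms by (auto simp: gbinomial_pochhammer' intro!: divide_pos_pos pochhammer_pos)

section \<open>Orthogonality through Beta integrals\<close>

text \<open>The substitution u = (1 + t) / 2 gives a Beta integral with parameters
  \<open>b + i + 1\<close> and \<open>a + l + 1\<close>; dt = 2 du accounts for one factor
  2.\<close>

lemma jacobi_moment:
  fixes a :: real
  assumes "a > - 1"
  shows "((\<lambda>t. (1 - t) powr a * (1 + t) powr real b * (((1 + t) / 2) ^ i * (1 - t) ^ l)) has_integral
     2 powr (a + real b + real l + 1) * Gamma (a + real l + 1) * fact (b + i) /
     Gamma (a + real b + real l + 2 + real i)) {- 1<..<1}" (is "(?f has_integral ?I) _")
proof -
  let ?g = "\<lambda>u::real. u powr (real (b + i) + 1 - 1) * (1 - u) powr (a + real l + 1 - 1)"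
  let ?B = "Beta (real (b + i) + 1) (a + real l + 1)"
  have "(?g has_integral ?B) {0..1}"
    using assms by (intro has_integral_Beta_real) auto
  moreover have "(\<lambda>x. x / (1 / 2) - 1 / 2 / (1 / 2)) ` {0..1} = {- 1..1 :: real}"
    by (subst image_affinity_atLeastAtMost_div_diff) auto
  ultimately have "((\<lambda>t. ?g (1 / 2 * t + 1 / 2)) has_integral 2 * ?B) {- 1..1}"
    using has_integral_affinity01[of ?g ?B "1 / 2" "1 / 2"] by simp
  then have "((\<lambda>t. ?g (1 / 2 * t + 1 / 2)) has_integral 2 * ?B) {- 1<..<1}"
    by (simp only: has_integral_Icc_iff_Ioo)
  \<comment> \<open>The constant collects the powers of 2 from (1 + t)^b = (2 u)^b and (1 - t)^(a +
    l) = (2 (1 - u))^(a + l); the factor \<open>((1 + t) / 2) ^ i\<close> is already u^i.\<close>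
  from has_integral_mult_right[OF this, of "2 powr (a + real b + real l)"]
  have "((\<lambda>t. 2 powr (a + real b + real l) * ?g (1 / 2 * t + 1 / 2)) has_integral
      2 powr (a + real b + real l) * (2 * ?B)) {- 1<..<1}" .
  moreover have "2 powr (a + real b + real l) * (2 * ?B) = ?I"
    using Gamma_fact[of "b + i", where ?'a = real]
    by (simp add: Beta_def powr_add add_ac)
  moreover have "2 powr (a + real b + real l) * ?g (1 / 2 * t + 1 / 2) = ?f t"
    if "t \<in> {- 1<..<1}" for t
  proof -
    have half: "1 / 2 * t + 1 / 2 = (1 + t) / 2" "1 - (1 + t) / 2 = (1 - t) / 2"
      by (simp_all add: field_simps)
    have "((1 + t) / 2) powr (real (b + i)) = (1 + t) powr b / 2 powr b * ((1 + t) / 2) ^ i"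
      using that by (simp add: powr_add powr_divide powr_realpow power_divide)
    moreover have "((1 - t) / 2) powr (a + real l) =
        (1 - t) powr a / 2 powr a * ((1 - t) ^ l / 2 powr l)"
      using that by (simp add: powr_add powr_divide powr_realpow power_divide)
    ultimately show ?thesis
      unfolding half add_diff_cancel_right' by (simp add: powr_add)
  qed
  ultimately show ?thesis
    using has_integral_eq by (metis (no_types, lifting))
qed

lemma jacobi_explicit_orthogonal_power:
  assumes a: "a > - 1" and "l < k"
  shows "((\<lambda>t. (1 - t) powr a * (1 + t) powr real b * poly (jacobi_explicit k a b) t * (1 - t) ^ l)
    has_integral 0) {- 1<..<1}"
proof -
  \<comment> \<open>\<open>C\<close> is the part of the moment that does not depend on
    \<open>i\<close>, \<open>y + i\<close> the Gamma argument in its denominator, and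
    \<open>x\<close> the base of the rising factorial in \<open>jacobi_coeff\<close>. Since
    \<open>x = y + d\<close>, the quotient Gamma(x + i) / Gamma(y + i) is a rising factorial of
    length \<open>d < k\<close>.\<close>
  define y where "y = a + real b + real l + 2"
  define d where "d = k - l - 1"
  define x where "x = a + real k + real b + 1"
  define C where "C = 2 powr (a + real b + real l + 1) * Gamma (a + real l + 1)"
  have "y > 0" "x > 0" using assms by (auto simp: y_def x_def)
  have yd: "y + real d = x"
    using \<open>l < k\<close> by (simp add: y_def d_def x_def of_nat_diff)
  have pos: "y + real w \<notin> \<int>\<^sub>\<le>\<^sub>0" for w
    using \<open>y > 0\<close> by (auto elim!: nonpos_Ints_cases)
  \<comment> \<open>The factor \<open>fact (b + i)\<close> of the moment cancels against the
    binomial in \<open>jacobi_coeff\<close>, which leaves a multiple of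
    \<open>k choose i\<close>.\<close>
  have summand: "jacobi_coeff k a b i * (C * fact (b + i) / Gamma (y + real i)) =
      (- 1) ^ k * C * fact (k + b) / (Gamma x * fact k) *
        ((- 1) ^ i * of_nat (k choose i) * pochhammer (y + real i) d)" if "i \<le> k" for i
  proof -
    have g: "Gamma (y + real i) > 0" "Gamma x > 0" "Gamma (x + real i) > 0"
      using \<open>y > 0\<close> \<open>x > 0\<close> by auto
    have "pochhammer x i = Gamma (x + real i) / Gamma x"
      using \<open>x > 0\<close> by (intro pochhammer_Gamma) (auto elim!: nonpos_Ints_cases)
    then have "jacobi_coeff k a b i = (- 1) ^ k * (- 1) ^ i * (Gamma (x + real i) / Gamma x) *
        (fact (k + b) / (fact (k - i) * fact (b + i))) / fact i"
      using that unfolding jacobi_coeff_def x_def [symmetric]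
      by (simp add: power_add binomial_fact add.commute)
    moreover have "pochhammer (y + real i) d = Gamma (x + real i) / Gamma (y + real i)"
      using pochhammer_Gamma[OF pos, of i d] by (simp add: yd[symmetric] add_ac)
    moreover have "real (k choose i) = fact k / (fact i * fact (k - i))"
      using that by (simp add: binomial_fact)
    ultimately show ?thesis
      using g by (simp add: mult_ac)
  qed
  have "((\<lambda>t. \<Sum>i\<le>k. jacobi_coeff k a b i *
      ((1 - t) powr a * (1 + t) powr real b * (((1 + t) / 2) ^ i * (1 - t) ^ l))) has_integral
      (\<Sum>i\<le>k. jacobi_coeff k a b i * (C * fact (b + i) / Gamma (y + real i)))) {- 1<..<1}"
    unfolding C_def y_def by (intro has_integral_sum has_integral_mult_right jacobi_moment a) auto
  moreover have "(\<Sum>i\<le>k. jacobi_coeff k a b i * (C * fact (b + i) / Gamma (y + real i))) = 0"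
  proof -
    have "(\<Sum>i\<le>k. jacobi_coeff k a b i * (C * fact (b + i) / Gamma (y + real i))) =
      (- 1) ^ k * C * fact (k + b) / (Gamma x * fact k) *
        (\<Sum>i\<le>k. (- 1) ^ i * of_nat (k choose i) * pochhammer (y + real i) d)"
      using summand by (simp add: sum_distrib_left)
    also have "\<dots> = 0"
      using \<open>l < k\<close> by (subst alternating_binomial_sum_pochhammer) (auto simp: d_def)
    finally show ?thesis .
  qed
  ultimately show ?thesis
    by (simp add: poly_jacobi_explicit sum_distrib_left sum_distrib_right mult_ac)
qed

lemma is_jacobi_poly_jacobi_explicit:
  assumes "a > - 1"
  shows "is_jacobi_poly k a (real b) (jacobi_explicit k a b)"
proof -
  have "((\<lambda>t. (1 - t) powr a * (1 + t) powr real b * poly (jacobi_explicit k a b) t * poly q t)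
      has_integral 0) {- 1<..<1}" if "degree q < k" for q
  proof -
    \<comment> \<open>The coefficients of \<open>p\<close> expand \<open>q\<close> in powers of 1 -
      t, and the degree is unchanged.\<close>
    define p where "p = q \<circ>\<^sub>p [:1, - 1:]"
    have "degree p < k"
      using that by (simp add: p_def degree_pcompose)
    have q: "poly q t = (\<Sum>l\<le>degree p. coeff p l * (1 - t) ^ l)" for t
    proof -
      have "poly q t = poly p (1 - t)"
        by (simp add: p_def poly_pcompose)
      then show ?thesis by (simp add: poly_altdef)
    qed
    have "((\<lambda>t. \<Sum>l\<le>degree p. coeff p l *
        ((1 - t) powr a * (1 + t) powr real b * poly (jacobi_explicit k a b) t * (1 - t) ^ l))
        has_integral (\<Sum>l\<le>degree p. coeff p l * 0)) {- 1<..<1}"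
      using \<open>degree p < k\<close> assms
      by (intro has_integral_sum has_integral_mult_right jacobi_explicit_orthogonal_power) auto
    then show ?thesis
      by (simp add: q sum_distrib_left mult_ac)
  qed
  then show ?thesis
    using assms by (simp add: is_jacobi_poly_def degree_jacobi_explicit poly_jacobi_explicit_1)
qed

section \<open>Uniqueness of the Jacobi polynomial\<close>

text \<open>The integrand is nonnegative, so its integral over [0, 1/2] vanishes as well. There,
  away from possible singularities at the end points, the weight is continuous and positive, so
  \<open>r\<close> has infinitely many roots.\<close>

lemma poly_eq_0_if_weighted_square_integral_0:
  fixes r :: "real poly"
  assumes "((\<lambda>t. (1 - t) powr a * (1 + t) powr b * poly r t * poly r t) has_integral 0) {- 1<..<1}"
  shows "r = 0"
proof (rule ccontr)
  assume "r \<noteq> 0"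
  let ?f = "\<lambda>t. (1 - t) powr a * (1 + t) powr b * poly r t * poly r t"
  have cont: "continuous_on (cbox 0 (1 / 2)) ?f"
    by (intro continuous_intros) auto
  have nonneg: "0 \<le> ?f t" for t
    by (simp add: mult.assoc)
  obtain I where I: "(?f has_integral I) (cbox 0 (1 / 2))"
    using integrable_continuous[OF cont] by (auto simp: integrable_on_def)
  have "I \<le> 0"
    using nonneg by (intro has_integral_subset_le[OF _ I assms]) auto
  moreover have "0 \<le> I"
    using has_integral_nonneg[OF I] nonneg by blast
  ultimately have "I = 0" by simp
  have "poly r t = 0" if "t \<in> cbox 0 (1 / 2)" for t
  proof -
    have "?f t = 0"
      using has_integral_0_cbox_imp_0[OF cont _ I[unfolded \<open>I = 0\<close>] _ that] nonneg by auto
    then show ?thesis using that by auto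
  qed
  then have "{0..1 / 2} \<subseteq> {t. poly r t = 0}" by auto
  then have "finite {0..1 / 2 :: real}"
    using poly_roots_finite[OF \<open>r \<noteq> 0\<close>] finite_subset by blast
  then show False
    by (simp add: infinite_Icc)
qed

text \<open>Cancelling the leading coefficients leaves a remainder of degree below \<open>k\<close>,
  which is orthogonal to itself and hence zero. So \<open>p\<close> is a multiple of
  \<open>q\<close>, and the nonzero common value at 1 fixes the factor.\<close>

lemma is_jacobi_poly_unique:
  assumes p: "is_jacobi_poly k a b p" and q: "is_jacobi_poly k a b q"
    and nz: "(real k + a) gchoose k \<noteq> 0"
  shows "p = q"
proof -
  have deg: "degree p = k" "degree q = k" and val: "poly p 1 = (real k + a) gchoose k"
    "poly q 1 = (real k + a) gchoose k"
    using p q by (auto simp: is_jacobi_poly_def)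
  have "q \<noteq> 0" using val nz by auto
  define c where "c = lead_coeff p / lead_coeff q"
  define r where "r = p - smult c q"
  have "coeff r k = 0"
    using deg \<open>q \<noteq> 0\<close> leading_coeff_neq_0[of q] by (simp add: r_def c_def)
  moreover have "degree r \<le> k"
    unfolding r_def using deg by (intro degree_diff_le) (auto intro: degree_smult_le order_trans)
  \<comment> \<open>If the degree were exactly \<open>k\<close>, the leading coefficient would be
    zero; for \<open>k = 0\<close> only \<open>r = 0\<close> is left.\<close>
  ultimately have "r = 0 \<or> degree r < k"
    by (metis le_neq_implies_less leading_coeff_0_iff)
  moreover have "r = 0" if "degree r < k"
  proof (rule poly_eq_0_if_weighted_square_integral_0)
    have "((\<lambda>t. (1 - t) powr a * (1 + t) powr b * poly p t * poly r t -
        c * ((1 - t) powr a * (1 + t) powr b * poly q t * poly r t)) has_integral 0 - c * 0) {- 1<..<1}"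
      using p q that by (intro has_integral_diff has_integral_mult_right) (auto simp: is_jacobi_poly_def)
    then show "((\<lambda>t. (1 - t) powr a * (1 + t) powr b * poly r t * poly r t) has_integral 0) {- 1<..<1}"
      by (simp add: r_def algebra_simps)
  qed
  ultimately have "p = smult c q"
    by (auto simp: r_def)
  with val nz show ?thesis by simp
qed

lemma jacobi_poly_eq_explicit:
  assumes "a > - 1"
  shows "jacobi_poly k a (real b) = jacobi_explicit k a b"
  unfolding jacobi_poly_def
  using is_jacobi_poly_jacobi_explicit[OF assms] gbinomial_add_pos[OF assms, of k]
  by (intro the_equality is_jacobi_poly_unique[of k a "real b"]) auto

section \<open>Monomial expansion of Zernike polynomials\<close>

text \<open>The binomials make the coefficient vanish for \<open>j > min m n\<close>; sums may
  therefore run to any larger bound, and truncated differences do no harm.\<close>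

definition zernike_coeff :: "real \<Rightarrow> nat \<Rightarrow> nat \<Rightarrow> nat \<Rightarrow> real" where
  "zernike_coeff \<alpha> m n j = (- 1) ^ j * pochhammer (\<alpha> + 1) (m + n - j) /
     (pochhammer (\<alpha> + 1) m * pochhammer (\<alpha> + 1) n) * fact j * of_nat (m choose j) * of_nat (n choose j)"

lemma zernike_coeff_commute: "zernike_coeff \<alpha> m n j = zernike_coeff \<alpha> n m j"
  by (simp add: zernike_coeff_def add.commute[of m] mult_ac)

lemma zernike_coeff_eq_0: "m < j \<or> n < j \<Longrightarrow> zernike_coeff \<alpha> m n j = 0"
  by (auto simp: zernike_coeff_def)

lemma zernike_coeff_eq:
  assumes "j \<le> m" "j \<le> n"
  shows "zernike_coeff \<alpha> m n j = (- 1) ^ j * pochhammer (\<alpha> + 1) (m + n - j) * fact m * fact n /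
     (pochhammer (\<alpha> + 1) m * pochhammer (\<alpha> + 1) n * fact j * fact (m - j) * fact (n - j))"
  using assms by (simp add: zernike_coeff_def binomial_fact field_simps)

text \<open>Here \<open>s\<close> stands for r^2. The Gamma prefactor is \<open>fact k\<close> over
  a rising factorial, and the reversal \<open>i = k - j\<close> makes \<open>j\<close> count the
  factors z z* missing from the top term.\<close>

lemma zernike_radial:
  assumes "\<alpha> > - 1"
  shows "Gamma (real k + 1) * Gamma (\<alpha> + 1) / Gamma (real k + \<alpha> + 1) *
      poly (jacobi_poly k \<alpha> (real b)) (2 * s - 1) =
    (\<Sum>j\<le>k. zernike_coeff \<alpha> (k + b) k j * s ^ (k - j))"
proof -
  have pos: "pochhammer (\<alpha> + 1) i > 0" for i
    using assms by (intro pochhammer_pos) auto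
  have "\<alpha> + 1 \<notin> \<int>\<^sub>\<le>\<^sub>0"
    using assms by (auto elim!: nonpos_Ints_cases)
  then have "pochhammer (\<alpha> + 1) k = Gamma (\<alpha> + 1 + real k) / Gamma (\<alpha> + 1)"
    by (rule pochhammer_Gamma)
  moreover have "Gamma (\<alpha> + 1) > 0" "Gamma (\<alpha> + 1 + real k) > 0"
    using assms by auto
  ultimately have pref: "Gamma (real k + 1) * Gamma (\<alpha> + 1) / Gamma (real k + \<alpha> + 1) =
      fact k / pochhammer (\<alpha> + 1) k"
    using Gamma_fact[of k, where ?'a = real] by (simp add: add_ac)
  have coeff: "fact k / pochhammer (\<alpha> + 1) k * jacobi_coeff k \<alpha> b (k - j) =
      zernike_coeff \<alpha> (k + b) k j" if "j \<le> k" for j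
  proof -
    \<comment> \<open>Splitting at length \<open>k + b\<close> isolates the rising factorial that
      occurs in \<open>jacobi_coeff\<close>.\<close>
    have "pochhammer (\<alpha> + 1) (k + b + k - j) =
        pochhammer (\<alpha> + 1) (k + b) * pochhammer (\<alpha> + real k + real b + 1) (k - j)"
      using pochhammer_product'[of "\<alpha> + 1" "k + b" "k - j"] that by (simp add: add_ac)
    moreover have "(- 1 :: real) ^ (k + (k - j)) = (- 1) ^ j"
      using that by (auto simp: minus_one_power_iff)
    ultimately show ?thesis
      using that pos[of k] pos[of "k + b"]
      by (simp add: zernike_coeff_eq jacobi_coeff_def binomial_fact field_simps)
  qed
  have "Gamma (real k + 1) * Gamma (\<alpha> + 1) / Gamma (real k + \<alpha> + 1) *
      poly (jacobi_poly k \<alpha> (real b)) (2 * s - 1) =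
      (\<Sum>i\<le>k. fact k / pochhammer (\<alpha> + 1) k * jacobi_coeff k \<alpha> b i * s ^ i)"
    unfolding pref by (simp add: jacobi_poly_eq_explicit[OF assms] poly_jacobi_explicit sum_distrib_left mult_ac)
  also have "\<dots> = (\<Sum>j\<le>k. fact k / pochhammer (\<alpha> + 1) k * jacobi_coeff k \<alpha> b (k - j) * s ^ (k - j))"
    by (rule sum.reindex_bij_witness[of _ "\<lambda>j. k - j" "\<lambda>j. k - j"]) auto
  also have "\<dots> = (\<Sum>j\<le>k. zernike_coeff \<alpha> (k + b) k j * s ^ (k - j))"
    by (intro sum.cong refl) (simp only: coeff atMost_iff)
  finally show ?thesis .
qed

text \<open>De Moivre's formula and its conjugate, for the two possible signs of m - n.\<close>

lemma polar_power:
  "of_real (cmod z ^ b) * exp (\<i> * of_nat b * of_real (Arg z)) = z ^ b"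
  "of_real (cmod z ^ b) * exp (- (\<i> * of_nat b * of_real (Arg z))) = cnj z ^ b"
proof -
  have "exp (\<i> * of_nat b * of_real (Arg z)) = cis (Arg z) ^ b"
    by (simp add: cis_conv_exp exp_of_nat_mult [symmetric] mult_ac)
  then show *: "of_real (cmod z ^ b) * exp (\<i> * of_nat b * of_real (Arg z)) = z ^ b"
    using rcis_cmod_Arg[of z] by (simp add: rcis_def flip: power_mult_distrib)
  show "of_real (cmod z ^ b) * exp (- (\<i> * of_nat b * of_real (Arg z))) = cnj z ^ b"
    using arg_cong[OF *, of cnj] by (simp add: exp_cnj)
qed

lemma of_real_cmod_power2: "(of_real (cmod z))\<^sup>2 = z * cnj z"
  by (metis complex_norm_square of_real_power)

text \<open>The angular factor is a power of z if n <= m and of z* otherwise; the powers of r^2 = z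
  z* from the radial part complete the monomials. The second case uses the symmetry of the
  coefficients.\<close>

lemma zernike_expansion_min:
  assumes "\<alpha> > - 1"
  shows "zernike \<alpha> (int m) (int n) z =
    (\<Sum>j\<le>min m n. of_real (zernike_coeff \<alpha> m n j) * z ^ (m - j) * cnj z ^ (n - j))"
proof (cases "n \<le> m")
  case True
  then obtain b where m: "m = n + b" by (metis le_iff_add)
  have "zernike \<alpha> (int m) (int n) z =
      of_real (cmod z ^ b) * exp (\<i> * of_nat b * of_real (Arg z)) *
      of_real (Gamma (real n + 1) * Gamma (\<alpha> + 1) / Gamma (real n + \<alpha> + 1) *
        poly (jacobi_poly n \<alpha> (real b)) (2 * (cmod z)\<^sup>2 - 1))"
    by (simp add: zernike_def m mult_ac)
  also have "\<dots> = z ^ b * (\<Sum>j\<le>n. of_real (zernike_coeff \<alpha> m n j) * (z * cnj z) ^ (n - j))"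
    unfolding zernike_radial[OF assms] polar_power by (simp add: m of_real_cmod_power2)
  also have "\<dots> = (\<Sum>j\<le>n. of_real (zernike_coeff \<alpha> m n j) * z ^ (m - j) * cnj z ^ (n - j))"
    unfolding sum_distrib_left
  proof (intro sum.cong refl)
    fix j assume "j \<in> {..n}"
    then have "m - j = b + (n - j)" by (simp add: m)
    then show "z ^ b * (of_real (zernike_coeff \<alpha> m n j) * (z * cnj z) ^ (n - j)) =
        of_real (zernike_coeff \<alpha> m n j) * z ^ (m - j) * cnj z ^ (n - j)"
      by (simp add: power_add power_mult_distrib)
  qed
  finally show ?thesis using True by (simp add: min_absorb2)
next
  case False
  then obtain b where n: "n = m + b" by (metis le_iff_add nat_le_linear)
  have "zernike \<alpha> (int m) (int n) z =
      of_real (cmod z ^ b) * exp (- (\<i> * of_nat b * of_real (Arg z))) *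
      of_real (Gamma (real m + 1) * Gamma (\<alpha> + 1) / Gamma (real m + \<alpha> + 1) *
        poly (jacobi_poly m \<alpha> (real b)) (2 * (cmod z)\<^sup>2 - 1))"
    by (simp add: zernike_def n mult_ac)
  also have "\<dots> = cnj z ^ b * (\<Sum>j\<le>m. of_real (zernike_coeff \<alpha> m n j) * (z * cnj z) ^ (m - j))"
    unfolding zernike_radial[OF assms] polar_power
    by (simp add: n of_real_cmod_power2 zernike_coeff_commute[of _ m])
  also have "\<dots> = (\<Sum>j\<le>m. of_real (zernike_coeff \<alpha> m n j) * z ^ (m - j) * cnj z ^ (n - j))"
    unfolding sum_distrib_left
  proof (intro sum.cong refl)
    fix j assume "j \<in> {..m}"
    then have "n - j = b + (m - j)" by (simp add: n)
    then show "cnj z ^ b * (of_real (zernike_coeff \<alpha> m n j) * (z * cnj z) ^ (m - j)) =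
        of_real (zernike_coeff \<alpha> m n j) * z ^ (m - j) * cnj z ^ (n - j)"
      by (simp add: power_add power_mult_distrib)
  qed
  finally show ?thesis using False by (simp add: min_absorb1)
qed

text \<open>The free bound \<open>N\<close> allows polynomials with different indices to be summed
  over a common range.\<close>

lemma zernike_expansion:
  assumes "\<alpha> > - 1" "min m n \<le> N"
  shows "zernike \<alpha> (int m) (int n) z =
    (\<Sum>j\<le>N. of_real (zernike_coeff \<alpha> m n j) * z ^ (m - j) * cnj z ^ (n - j))"
  unfolding zernike_expansion_min[OF assms(1)]
  using assms(2) by (intro sum.mono_neutral_left) (auto simp: zernike_coeff_eq_0)

section \<open>Wirtinger derivatives of the expansion\<close>

text \<open>The derivative takes the value A + B in direction 1 and i (A - B) in direction i; the
  Wirtinger combinations separate the two coefficients.\<close>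

lemma deriv_wirtinger:
  assumes "(f has_derivative (\<lambda>h. A * h + B * cnj h)) (at z)"
  shows "deriv_z f z = A" "deriv_zstar f z = B"
proof -
  have "((\<lambda>x. f (Complex x (Im z))) has_vector_derivative A + B) (at (Re z))"
  proof -
    have "((\<lambda>x. Complex x (Im z)) has_derivative (\<lambda>h. of_real h)) (at (Re z))"
      unfolding complex_of_real_mult_Complex Complex_eq by (auto intro!: derivative_eq_intros)
    from has_derivative_compose[OF this, of f "\<lambda>h. A * h + B * cnj h"] assms show ?thesis
      by (simp add: has_vector_derivative_def scaleR_conv_of_real algebra_simps)
  qed
  then have 1: "partial1 f z = A + B"
    by (simp add: partial1_def vector_derivative_at)
  have "((\<lambda>y. f (Complex (Re z) y)) has_vector_derivative \<i> * (A - B)) (at (Im z))"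
  proof -
    have "((\<lambda>y. Complex (Re z) y) has_derivative (\<lambda>h. \<i> * of_real h)) (at (Im z))"
      unfolding Complex_eq by (auto intro!: derivative_eq_intros)
    from has_derivative_compose[OF this, of f "\<lambda>h. A * h + B * cnj h"] assms show ?thesis
      by (simp add: has_vector_derivative_def scaleR_conv_of_real algebra_simps)
  qed
  then have 2: "partial2 f z = \<i> * (A - B)"
    by (simp add: partial2_def vector_derivative_at)
  show "deriv_z f z = A" "deriv_zstar f z = B"
    by (simp_all add: deriv_z_def deriv_zstar_def 1 2 algebra_simps)
qed

text \<open>z and z* behave like independent variables. For \<open>p = 0\<close> or
  \<open>q = 0\<close> the truncated exponent comes with the factor 0.\<close>

lemma has_derivative_monomial_cnj:
  "((\<lambda>z. c * z ^ p * cnj z ^ q) has_derivative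
     (\<lambda>h. (of_nat p * c * z ^ (p - 1) * cnj z ^ q) * h +
          (of_nat q * c * z ^ p * cnj z ^ (q - 1)) * cnj h)) (at z)"
proof -
  have "(cnj has_derivative cnj) (at z)"
    by (rule bounded_linear.has_derivative[OF bounded_linear_cnj has_derivative_ident])
  then show ?thesis
    by (auto intro!: derivative_eq_intros simp: algebra_simps)
qed

lemma deriv_zernike:
  assumes "\<alpha> > - 1" "min m n \<le> N"
  shows "deriv_z (zernike \<alpha> (int m) (int n)) z =
      (\<Sum>j\<le>N. of_nat (m - j) * of_real (zernike_coeff \<alpha> m n j) * z ^ (m - j - 1) * cnj z ^ (n - j))"
    and "deriv_zstar (zernike \<alpha> (int m) (int n)) z =
      (\<Sum>j\<le>N. of_nat (n - j) * of_real (zernike_coeff \<alpha> m n j) * z ^ (m - j) * cnj z ^ (n - j - 1))"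
proof -
  have eq: "zernike \<alpha> (int m) (int n) =
      (\<lambda>z. \<Sum>j\<le>N. of_real (zernike_coeff \<alpha> m n j) * z ^ (m - j) * cnj z ^ (n - j))"
    by (rule ext) (rule zernike_expansion[OF assms])
  have "(zernike \<alpha> (int m) (int n) has_derivative (\<lambda>h. \<Sum>j\<le>N.
      (of_nat (m - j) * of_real (zernike_coeff \<alpha> m n j) * z ^ (m - j - 1) * cnj z ^ (n - j)) * h +
      (of_nat (n - j) * of_real (zernike_coeff \<alpha> m n j) * z ^ (m - j) * cnj z ^ (n - j - 1)) * cnj h))
      (at z)"
    unfolding eq by (intro has_derivative_sum has_derivative_monomial_cnj)
  then have "(zernike \<alpha> (int m) (int n) has_derivative (\<lambda>h.
      (\<Sum>j\<le>N. of_nat (m - j) * of_real (zernike_coeff \<alpha> m n j) * z ^ (m - j - 1) * cnj z ^ (n - j)) * h +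
      (\<Sum>j\<le>N. of_nat (n - j) * of_real (zernike_coeff \<alpha> m n j) * z ^ (m - j) * cnj z ^ (n - j - 1)) * cnj h))
      (at z)"
    by (simp only: sum.distrib sum_distrib_right)
  from deriv_wirtinger[OF this] show "deriv_z (zernike \<alpha> (int m) (int n)) z =
      (\<Sum>j\<le>N. of_nat (m - j) * of_real (zernike_coeff \<alpha> m n j) * z ^ (m - j - 1) * cnj z ^ (n - j))"
    "deriv_zstar (zernike \<alpha> (int m) (int n)) z =
      (\<Sum>j\<le>N. of_nat (n - j) * of_real (zernike_coeff \<alpha> m n j) * z ^ (m - j) * cnj z ^ (n - j - 1))" .
qed

section \<open>Coefficient identities\<close>

text \<open>Both sides are the rising factorial of length \<open>k + 1\<close>, split off at either
  end.\<close>

lemma pochhammer_shift: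
  fixes x :: "'a :: comm_ring_1"
  shows "x * pochhammer (x + 1) k = pochhammer x k * (x + of_nat k)"
  by (metis pochhammer_Suc pochhammer_rec)

text \<open>Raising \<alpha> multiplies each rising factorial of length i by (\<alpha> + 1 + i) /
  (\<alpha> + 1). Length m + n - j gives the factor on the left, lengths m and n those on the
  right.\<close>

lemma zernike_coeff_raise:
  assumes "\<alpha> > - 1"
  shows "(real m + real n + \<alpha> + 1 - real j) * zernike_coeff \<alpha> m n j =
    (real m + \<alpha> + 1) * (real n + \<alpha> + 1) / (\<alpha> + 1) * zernike_coeff (\<alpha> + 1) m n j"
proof (cases "j \<le> m \<and> j \<le> n")
  case True
  have pos: "pochhammer (\<alpha> + 1) i > 0" "\<alpha> + 1 + real i > 0" for i
    using assms by (auto intro!: pochhammer_pos)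
  have shift: "pochhammer (\<alpha> + 1 + 1) i = pochhammer (\<alpha> + 1) i * (\<alpha> + 1 + real i) / (\<alpha> + 1)" for i
    using pochhammer_shift[of "\<alpha> + 1" i] assms by (simp add: field_simps)
  have eqs: "real (m + n - j) = real m + real n - real j"
    "real m + \<alpha> + 1 = \<alpha> + 1 + real m" "real n + \<alpha> + 1 = \<alpha> + 1 + real n"
    "real m + real n + \<alpha> + 1 - real j = \<alpha> + 1 + (real m + real n - real j)"
    using True by auto
  show ?thesis
    using pos[of m] pos[of n] assms unfolding zernike_coeff_def shift eqs by simp
next
  case False
  then show ?thesis by (auto simp: zernike_coeff_eq_0)
qed

text \<open>Each of the three rising factorials on the left loses its first factor \<alpha> + 1, one
  in the numerator and two in the denominator. The sign comes from the shift of
  \<open>j\<close>.\<close>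

lemma zernike_coeff_raise_Suc:
  assumes "\<alpha> > - 1"
  shows "real (Suc j) * zernike_coeff \<alpha> (Suc m) (Suc n) (Suc j) =
    - (real (Suc m) * real (Suc n) / (\<alpha> + 1)) * zernike_coeff (\<alpha> + 1) m n j"
proof (cases "j \<le> m \<and> j \<le> n")
  case True
  have pos: "pochhammer (\<alpha> + 1 + 1) i > 0" for i
    using assms by (intro pochhammer_pos) auto
  have "Suc m + Suc n - Suc j = Suc (m + n - j)"
    using True by (simp add: Suc_diff_le)
  then show ?thesis
    using True assms pos[of m] pos[of n]
    by (simp add: zernike_coeff_eq pochhammer_rec[of "\<alpha> + 1"] divide_simps)
next
  case False
  then show ?thesis by (auto simp: zernike_coeff_eq_0)
qed

text \<open>Raising \<open>n\<close> adds a last factor to the rising factorials of lengths m + n -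
  j and n, and differentiation cancels the new factor of (n + 1 - j)!.\<close>

lemma zernike_coeff_deriv:
  assumes "\<alpha> > - 1"
  shows "(real m + real n + \<alpha> + 1 - real j) * zernike_coeff \<alpha> m n j =
    (real n + \<alpha> + 1) / (real n + 1) * (real (Suc n - j) * zernike_coeff \<alpha> m (Suc n) j)"
proof (cases "j \<le> m \<and> j \<le> n")
  case True
  have pos: "pochhammer (\<alpha> + 1) i > 0" "\<alpha> + 1 + real i > 0" for i
    using assms by (auto intro!: pochhammer_pos)
  have eqs: "Suc (m + n) - j = Suc (m + n - j)" "Suc n - j = Suc (n - j)"
    "real n + \<alpha> + 1 = \<alpha> + 1 + real n" "real n + 1 = real (Suc n)"
    "real m + real n + \<alpha> + 1 - real j = \<alpha> + 1 + real (m + n - j)"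
    using True by auto
  show ?thesis
    using True assms pos[of m] pos[of n] unfolding eqs
    by (simp add: zernike_coeff_eq eqs pochhammer_Suc mult_ac del: of_nat_Suc)
next
  \<comment> \<open>For \<open>j = Suc n\<close> the coefficient on the right need not vanish, but
    \<open>Suc n - j\<close> does.\<close>
  case False
  then show ?thesis by (auto simp: zernike_coeff_eq_0 not_le less_Suc_eq_le)
qed

text \<open>Raising both \<open>m\<close> and \<open>j\<close> keeps the length of the numerator, so
  only the denominator gains a factor, \<alpha> + 1 + m.\<close>

lemma zernike_coeff_deriv_Suc:
  assumes "\<alpha> > - 1"
  shows "real (Suc j) * zernike_coeff \<alpha> (Suc m) n (Suc j) =
    - (real (Suc m) / (real (Suc m) + \<alpha>)) * (real (n - j) * zernike_coeff \<alpha> m n j)"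
proof (cases "j \<le> m \<and> j < n")
  case True
  have pos: "pochhammer (\<alpha> + 1) i > 0" "\<alpha> + 1 + real i > 0" for i
    using assms by (auto intro!: pochhammer_pos)
  have "n - j = Suc (n - Suc j)" "Suc m + n - Suc j = m + n - j"
    using True by auto
  moreover have "real (Suc m) + \<alpha> = \<alpha> + 1 + real m"
    by auto
  ultimately show ?thesis
    using True assms pos[of m] pos[of n]
    by (simp add: zernike_coeff_eq pochhammer_Suc divide_simps)
next
  case False
  then show ?thesis by (auto simp: zernike_coeff_eq_0 not_le not_less)
qed

text \<open>
  In all three identities the factor \<open>s = m + n + \<alpha> + 1\<close> is split as \<open>(s - j) + j\<close> in front of the
  \<open>j\<close>-th coefficient: the two parts give the two terms of the right-hand side.
\<close>

lemma sum_split_index: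
  fixes x :: "nat \<Rightarrow> complex"
  shows "of_real s * (\<Sum>j\<le>N. of_real (c j) * x j) =
    (\<Sum>j\<le>N. of_real ((s - real j) * c j) * x j) +
    (\<Sum>j<N. of_real (real (Suc j) * c (Suc j)) * x (Suc j))"
proof -
  have "of_real s * (\<Sum>j\<le>N. of_real (c j) * x j) =
      (\<Sum>j\<le>N. of_real ((s - real j) * c j) * x j) + (\<Sum>j\<le>N. of_real (real j * c j) * x j)"
    by (simp add: sum_distrib_left algebra_simps flip: sum.distrib)
  \<comment> \<open>The term \<open>j = 0\<close> has the factor 0, so the index can be
    shifted.\<close>
  also have "(\<Sum>j\<le>N. of_real (real j * c j) * x j) =
      (\<Sum>j<N. of_real (real (Suc j) * c (Suc j)) * x (Suc j))"
    by (cases N) (simp_all add: sum.atMost_Suc_shift lessThan_Suc_atMost del: of_nat_Suc sum.atMost_Suc)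
  finally show ?thesis .
qed

lemma zernike_split:
  assumes "\<alpha> > - 1" "min m n \<le> N"
  shows "of_real s * zernike \<alpha> (int m) (int n) z =
    (\<Sum>j\<le>N. of_real ((s - real j) * zernike_coeff \<alpha> m n j) * (z ^ (m - j) * cnj z ^ (n - j))) +
    (\<Sum>j<N. of_real (real (Suc j) * zernike_coeff \<alpha> m n (Suc j)) *
      (z ^ (m - Suc j) * cnj z ^ (n - Suc j)))"
  unfolding zernike_expansion[OF assms] mult.assoc by (rule sum_split_index)

section \<open>The three identities for natural indices\<close>

lemma zernike_raise:
  assumes "\<alpha> > - 1"
  shows "of_real (real m + real n + \<alpha> + 1) * zernike \<alpha> (int m) (int n) z =
      of_real ((real m + \<alpha> + 1) * (real n + \<alpha> + 1) / (\<alpha> + 1)) * zernike (\<alpha> + 1) (int m) (int n) z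
    - of_real (real m * real n / (\<alpha> + 1)) * zernike (\<alpha> + 1) (int m - 1) (int n - 1) z"
proof -
  have "\<alpha> + 1 > - 1" using assms by simp
  note exp = zernike_expansion[OF this]
  have "(\<Sum>j<m. of_real (real (Suc j) * zernike_coeff \<alpha> m n (Suc j)) *
      (z ^ (m - Suc j) * cnj z ^ (n - Suc j))) =
    - (of_real (real m * real n / (\<alpha> + 1)) * zernike (\<alpha> + 1) (int m - 1) (int n - 1) z)"
  \<comment> \<open>In the boundary case the coefficients with index \<open>Suc j\<close> vanish or
    the sum is empty, and on the right m n = 0.\<close>
  proof (cases "m = 0 \<or> n = 0")
    case True
    then show ?thesis by (auto simp: zernike_coeff_eq_0)
  next
    case False
    then obtain p q where [simp]: "m = Suc p" "n = Suc q"
      by (metis not0_implies_Suc)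
    have "zernike (\<alpha> + 1) (int m - 1) (int n - 1) z = zernike (\<alpha> + 1) (int p) (int q) z"
      by simp
    then show ?thesis
      unfolding exp[of p q p, OF min.cobounded1] \<open>m = Suc p\<close> \<open>n = Suc q\<close>
        zernike_coeff_raise_Suc[OF assms] lessThan_Suc_atMost
      by (simp add: sum_distrib_left mult.assoc flip: sum_negf)
  qed
  then show ?thesis
    unfolding zernike_split[OF assms min.cobounded1] exp[of m n m, OF min.cobounded1]
      zernike_coeff_raise[OF assms]
    by (simp add: sum_distrib_left mult.assoc)
qed

lemma zernike_deriv_zstar:
  assumes "\<alpha> > - 1"
  shows "of_real (real m + real n + \<alpha> + 1) * zernike \<alpha> (int m) (int n) z =
      of_real ((real n + \<alpha> + 1) / (real n + 1)) * deriv_zstar (zernike \<alpha> (int m) (int n + 1)) z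
    - of_real (real m / (real m + \<alpha>)) * deriv_zstar (zernike \<alpha> (int m - 1) (int n)) z"
proof -
  have "(\<Sum>j<m. of_real (real (Suc j) * zernike_coeff \<alpha> m n (Suc j)) *
      (z ^ (m - Suc j) * cnj z ^ (n - Suc j))) =
    - (of_real (real m / (real m + \<alpha>)) * deriv_zstar (zernike \<alpha> (int m - 1) (int n)) z)"
  \<comment> \<open>For \<open>m = 0\<close> the sum is empty and the prefactor is 0, also for
    \<alpha> = 0 because 0 / 0 evaluates to 0.\<close>
  proof (cases m)
    case (Suc p)
    have "deriv_zstar (zernike \<alpha> (int m - 1) (int n)) z = deriv_zstar (zernike \<alpha> (int p) (int n)) z"
      by (simp add: Suc)
    then show ?thesis
      unfolding deriv_zernike(2)[OF assms min.cobounded1] Suc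
        zernike_coeff_deriv_Suc[OF assms] lessThan_Suc_atMost
      by (simp add: sum_distrib_left mult.assoc flip: sum_negf)
  qed simp
  moreover have "deriv_zstar (zernike \<alpha> (int m) (int n + 1)) z =
      deriv_zstar (zernike \<alpha> (int m) (int (Suc n))) z"
    by (simp add: add.commute)
  ultimately show ?thesis
    unfolding zernike_split[OF assms min.cobounded1] deriv_zernike(2)[OF assms min.cobounded1]
      zernike_coeff_deriv[OF assms]
    by (simp add: sum_distrib_left mult.assoc)
qed

lemma zernike_deriv_z:
  assumes "\<alpha> > - 1"
  shows "of_real (real m + real n + \<alpha> + 1) * zernike \<alpha> (int m) (int n) z =
      of_real ((real m + \<alpha> + 1) / (real m + 1)) * deriv_z (zernike \<alpha> (int m + 1) (int n)) z
    - of_real (real n / (real n + \<alpha>)) * deriv_z (zernike \<alpha> (int m) (int n - 1)) z"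
proof -
  \<comment> \<open>The bound is now \<open>n\<close>, and the indices of the coefficients are
    swapped, so that the coefficient identities for the z* derivative apply with \<open>m\<close>
    and \<open>n\<close> exchanged.\<close>
  have "(\<Sum>j<n. of_real (real (Suc j) * zernike_coeff \<alpha> n m (Suc j)) *
      (z ^ (m - Suc j) * cnj z ^ (n - Suc j))) =
    - (of_real (real n / (real n + \<alpha>)) * deriv_z (zernike \<alpha> (int m) (int n - 1)) z)"
  proof (cases n)
    case (Suc p)
    have "deriv_z (zernike \<alpha> (int m) (int n - 1)) z = deriv_z (zernike \<alpha> (int m) (int p)) z"
      by (simp add: Suc)
    then show ?thesis
      unfolding deriv_zernike(1)[OF assms min.cobounded2] Suc
        zernike_coeff_deriv_Suc[OF assms] lessThan_Suc_atMost zernike_coeff_commute[of _ m p]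
      by (simp add: sum_distrib_left mult_ac flip: sum_negf)
  qed simp
  moreover have "deriv_z (zernike \<alpha> (int m + 1) (int n)) z =
      deriv_z (zernike \<alpha> (int (Suc m)) (int n)) z"
    by (simp add: add.commute)
  moreover have "real m + real n + \<alpha> + 1 = real n + real m + \<alpha> + 1"
    by simp
  ultimately show ?thesis
    unfolding zernike_split[OF assms min.cobounded2] deriv_zernike(1)[OF assms min.cobounded2]
      zernike_coeff_commute[of _ m n] zernike_coeff_commute[of _ "Suc m" n]
    by (simp only: zernike_coeff_deriv[OF assms])
      (simp add: sum_distrib_left mult_ac)
qed

theorem proposition3p2:
  fixes \<alpha> :: real and m n :: int and z :: complex
  assumes "\<alpha> > - 1" and "m \<ge> 0" and "n \<ge> 0" and "z \<in> ball 0 1"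
  shows "(of_real (of_int m + of_int n + \<alpha> + 1) * zernike \<alpha> m n z =
           of_real ((of_int m + \<alpha> + 1) * (of_int n + \<alpha> + 1) / (\<alpha> + 1)) * zernike (\<alpha> + 1) m n z
         - of_real (of_int m * of_int n / (\<alpha> + 1)) * zernike (\<alpha> + 1) (m - 1) (n - 1) z) \<and>
         (of_real (of_int m + of_int n + \<alpha> + 1) * zernike \<alpha> m n z =
           of_real ((of_int n + \<alpha> + 1) / (of_int n + 1)) * deriv_zstar (zernike \<alpha> m (n + 1)) z
         - of_real (of_int m / (of_int m + \<alpha>)) * deriv_zstar (zernike \<alpha> (m - 1) n) z) \<and>
         (of_real (of_int m + of_int n + \<alpha> + 1) * zernike \<alpha> m n z =
           of_real ((of_int m + \<alpha> + 1) / (of_int m + 1)) * deriv_z (zernike \<alpha> (m + 1) n) z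
         - of_real (of_int n / (of_int n + \<alpha>)) * deriv_z (zernike \<alpha> m (n - 1)) z)"
proof -
  obtain p q where "m = int p" "n = int q"
    using assms by (metis nonneg_int_cases)
  then show ?thesis
    using zernike_raise[OF assms(1), of p q z] zernike_deriv_zstar[OF assms(1), of p q z]
      zernike_deriv_z[OF assms(1), of p q z]
    by simp
qed

end
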